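(* For relatively prime integers $p,q$ with $p$ even, let $R_{p/q}$ denote the oriented rational $\frac pq$-link and $lk(R_{p/q})$ the linking number of its two components. Then the following hold: (1) $lk(R_{0/1}) = 0$. (2) $lk(R_{p/q}) = -lk(R_{(-p)/q})$ for all relatively prime integers $p,q$ with $p$ even. (3) $lk(R_{p/q}) = lk(R_{(p+2q)/q}) - 1$ for all relatively prime integers $p,q$ with $p$ even. (4) $lk(R_{p/q}) = -lk(R_{p/(p+q)})$ for all relatively prime integers $p,q$ with $p$ even.
   Context: Linking number: for an oriented link diagram, a crossing between two different components is positive if the overstrand passes the understrand from left to right (as seen when travelling along the oriented understrand), and negative otherwise. The linking number of two components is half the sum of the signs of the crossings between them. Rational tangles: a 2-tangle is a proper embedding of two disjoint arcs in a 3-ball whose four endpoints lie on the boundary sphere and are labelled NW, NE, SW, SE. Let $T_0$ be the 2-tangle made of two horizontal arcs without crossings (joining NW to NE and SW to SE); its fraction is $0/1$. A rational tangle is a 2-tangle obtained from $T_0$ by horizontal and vertical twists. Let $[+1]$ be the one-crossing tangle whose overstrand has positive slope (runs from SW to NE), and $[-1]$ the one whose overstrand has negative slope. Adding a positive (resp. negative) horizontal twist means placing $[+1]$ (resp. $[-1]$) to the right of the tangle and joining adjacent endpoints; it changes the fraction $F$ to $F+1$ (resp. $F-1$). Adding a positive (resp. negative) vertical twist means placing $[+1]$ (resp. $[-1]$) below the tangle and joining adjacent endpoints; it changes the fraction $F$ so that $1/F$ becomes $1/F+1$ (resp. $1/F-1$), with $1/0=\infty$ and $1/\infty=0$. Correspondingly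 the rational tangle $T(a_1,\dots,a_n)$ in Conway notation has fraction $\frac pq = a_n+\cfrac{1}{a_{n-1}+\cfrac{1}{\ddots+\cfrac{1}{a_1}}}$ with $p,q$ relatively prime. By Conway's theorem two rational tangles are equivalent (isotopic fixing the endpoints) if and only if their fractions are equal. A rational $\frac pq$-tangle is a rational tangle with fraction $\frac pq$. Rational links: the numerator closure $N(T)$ of a rational tangle $T$ is obtained by joining NW with NE and SW with SE by arcs outside the ball, without crossings. When $p$ is even (so $q$ is odd), the strands of a rational $\frac pq$-tangle $T$ join NW to NE and SW to SE, so $N(T)$ has two components. $R_{p/q}$ is the oriented link $N(T)$ in which the strand with endpoints NE, NW is oriented from NE to NW and the other strand is oriented from SW to SE. With these conventions $lk(R_{2/1})=1$. *)

theory Defs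
  imports Complex_Main
begin

text \<open>
  Diagrams are recorded up to planar isotopy in the style of planar-diagram codes: the arcs of a
  diagram (its edges between consecutive crossings or end points) carry labels, and every crossing
  lists the labels of the arcs at its four corners. Every crossing is drawn with its two strands
  along the diagonals, so that opposite corners belong to the same strand.
\<close>

datatype corner = NW | NE | SW | SE

fun opp :: "corner \<Rightarrow> corner" where
  "opp NW = SE" | "opp SE = NW" | "opp NE = SW" | "opp SW = NE"

fun clockwise :: "corner \<Rightarrow> corner" where
  "clockwise NW = NE" | "clockwise NE = SE" | "clockwise SE = SW" | "clockwise SW = NW"

text \<open>The slope of the overstrand: \<open>Pos\<close> is the crossing $[+1]$ and \<open>Neg\<close> is $[-1]$.\<close>

datatype slope = Pos | Neg

fun over_corners :: "slope \<Rightarrow> corner set" where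
  "over_corners Pos = {SW, NE}" | "over_corners Neg = {NW, SE}"

fun twist_sign :: "slope \<Rightarrow> rat" where
  "twist_sign Pos = 1" | "twist_sign Neg = -1"

record crossing =
  over_slope :: slope
  arc_at :: "corner \<Rightarrow> nat"

record tangle =
  crossings :: "crossing list"
  ends :: "corner \<Rightarrow> nat"

definition arcs :: "tangle \<Rightarrow> nat set" where
  "arcs T = range (ends T) \<union> (\<Union>k \<in> set (crossings T). range (arc_at k))"

definition trivial_tangle :: "nat \<Rightarrow> nat \<Rightarrow> tangle" where
  "trivial_tangle x y =
     \<lparr>crossings = [], ends = (\<lambda>c. case c of NW \<Rightarrow> x | NE \<Rightarrow> x | SW \<Rightarrow> y | SE \<Rightarrow> y)\<rparr>"

text \<open>
  Twists: the new crossing is glued along two of its corners to the end points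
  NE, SE (horizontal) or SW, SE (vertical) of the tangle, and \<open>x\<close>, \<open>y\<close> label its two free arcs.
\<close>

definition horizontal_twist :: "slope \<Rightarrow> nat \<Rightarrow> nat \<Rightarrow> tangle \<Rightarrow> tangle" where
  "horizontal_twist s x y T =
     \<lparr>crossings = crossings T @
        [\<lparr>over_slope = s,
          arc_at = (\<lambda>c. case c of NW \<Rightarrow> ends T NE | SW \<Rightarrow> ends T SE | NE \<Rightarrow> x | SE \<Rightarrow> y)\<rparr>],
      ends = (ends T)(NE := x, SE := y)\<rparr>"

definition vertical_twist :: "slope \<Rightarrow> nat \<Rightarrow> nat \<Rightarrow> tangle \<Rightarrow> tangle" where
  "vertical_twist s x y T =
     \<lparr>crossings = crossings T @
        [\<lparr>over_slope = s,
          arc_at = (\<lambda>c. case c of NW \<Rightarrow> ends T SW | NE \<Rightarrow> ends T SE | SW \<Rightarrow> x | SE \<Rightarrow> y)\<rparr>],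
      ends = (ends T)(SW := x, SE := y)\<rparr>"

text \<open>Fractions live in the rationals together with $\infty$, which is represented by \<open>None\<close>.\<close>

fun ext_inverse :: "rat option \<Rightarrow> rat option" where
  "ext_inverse None = Some 0"
| "ext_inverse (Some r) = (if r = 0 then None else Some (inverse r))"

definition ext_add :: "rat option \<Rightarrow> rat \<Rightarrow> rat option" where
  "ext_add F r = map_option (\<lambda>f. f + r) F"

text \<open>\<open>rational_tangle T F\<close>: the diagram \<open>T\<close> is built from $T_0$ by twists, with fraction \<open>F\<close>.\<close>

inductive rational_tangle :: "tangle \<Rightarrow> rat option \<Rightarrow> bool" where
  trivial: "x \<noteq> y \<Longrightarrow> rational_tangle (trivial_tangle x y) (Some 0)"
| horizontal: "rational_tangle T F \<Longrightarrow> x \<notin> arcs T \<Longrightarrow> y \<notin> arcs T \<Longrightarrow> x \<noteq> y \<Longrightarrow>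
    rational_tangle (horizontal_twist s x y T) (ext_add F (twist_sign s))"
| vertical: "rational_tangle T F \<Longrightarrow> x \<notin> arcs T \<Longrightarrow> y \<notin> arcs T \<Longrightarrow> x \<noteq> y \<Longrightarrow>
    rational_tangle (vertical_twist s x y T)
      (ext_inverse (ext_add (ext_inverse F) (twist_sign s)))"

text \<open>
  A port is an end of an arc: an end point of the tangle, or a corner of the \<open>i\<close>-th crossing.
  An orientation is given by the set of ports at which an arc starts. Thus \<open>Bd c \<in> D\<close> means that
  the strand runs from the end point \<open>c\<close> into the tangle, and \<open>Cr i c \<in> D\<close> that the strand leaves
  the crossing \<open>i\<close> through its corner \<open>c\<close>.
\<close>

datatype port = Bd corner | Cr nat corner

definition ports :: "tangle \<Rightarrow> port set" where
  "ports T = range Bd \<union> {Cr i c | i c. i < length (crossings T)}"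

fun port_arc :: "tangle \<Rightarrow> port \<Rightarrow> nat" where
  "port_arc T (Bd c) = ends T c"
| "port_arc T (Cr i c) = arc_at (crossings T ! i) c"

definition orientation :: "tangle \<Rightarrow> port set \<Rightarrow> bool" where
  "orientation T D \<longleftrightarrow>
     D \<subseteq> ports T \<and>
     (\<forall>i < length (crossings T). \<forall>c. Cr i c \<in> D \<longleftrightarrow> Cr i (opp c) \<notin> D) \<and>
     (\<forall>p \<in> ports T. \<forall>p' \<in> ports T.
        p \<noteq> p' \<and> port_arc T p = port_arc T p' \<longrightarrow> (p \<in> D \<longleftrightarrow> p' \<notin> D))"

text \<open>
  Oriented link diagrams. Crossingless circles are arcs that occur at no crossing; the orientation
  of such a circle is not recorded. \<open>(i, c) \<in> exits L\<close> means that the strand leaves the \<open>i\<close>-th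
  crossing through its corner \<open>c\<close>.
\<close>

record link =
  link_arcs :: "nat set"
  link_crossings :: "crossing list"
  exits :: "(nat \<times> corner) set"

definition strand_step :: "link \<Rightarrow> (nat \<times> nat) set" where
  "strand_step L = {(arc_at k c, arc_at k (opp c)) | k c. k \<in> set (link_crossings L)}"

definition components :: "link \<Rightarrow> nat set set" where
  "components L = link_arcs L // (strand_step L)\<^sup>*"

definition crosses_over :: "crossing \<Rightarrow> nat set \<Rightarrow> nat set \<Rightarrow> bool" where
  "crosses_over k A B \<longleftrightarrow>
     (\<forall>c. arc_at k c \<in> (if c \<in> over_corners (over_slope k) then A else B))"

text \<open>
  Seen along the understrand leaving through the corner \<open>c\<close>, the overstrand passes from left to
  right iff it leaves through the corner that follows \<open>c\<close> in clockwise order.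
\<close>

definition crossing_sign :: "link \<Rightarrow> nat \<Rightarrow> rat" where
  "crossing_sign L i =
     (if \<exists>c. c \<notin> over_corners (over_slope (link_crossings L ! i)) \<and>
             (i, c) \<in> exits L \<and> (i, clockwise c) \<in> exits L
      then 1 else -1)"

definition linking_number :: "link \<Rightarrow> nat set \<Rightarrow> nat set \<Rightarrow> rat" where
  "linking_number L A B =
     (\<Sum>i | i < length (link_crossings L) \<and>
          (crosses_over (link_crossings L ! i) A B \<or> crosses_over (link_crossings L ! i) B A).
        crossing_sign L i) / 2"

definition lk :: "link \<Rightarrow> rat" where
  "lk L = (THE l. \<exists>A B. components L = {A, B} \<and> A \<noteq> B \<and> l = linking_number L A B)"

text \<open>
  The numerator closure merges the arcs ending at NW and NE, and then those ending at SW and SE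
  (one after the other, since the first merging may affect the arcs of the second).
\<close>

definition merge :: "nat \<Rightarrow> nat \<Rightarrow> nat \<Rightarrow> nat" where
  "merge x y a = (if a = x then y else a)"

definition closure_arc :: "tangle \<Rightarrow> nat \<Rightarrow> nat" where
  "closure_arc T =
     (let m = merge (ends T NE) (ends T NW) in merge (m (ends T SE)) (m (ends T SW)) \<circ> m)"

definition numerator_closure :: "tangle \<Rightarrow> port set \<Rightarrow> link" where
  "numerator_closure T D =
     \<lparr>link_arcs = closure_arc T ` arcs T,
      link_crossings = map (\<lambda>k. k\<lparr>arc_at := closure_arc T \<circ> arc_at k\<rparr>) (crossings T),
      exits = {(i, c). Cr i c \<in> D}\<rparr>"

text \<open>
  All diagrams of the oriented rational $p/q$-link obtained from rational $p/q$-tangles, for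
  coprime \<open>p\<close>, \<open>q\<close> with \<open>p\<close> even; then \<open>q \<noteq> 0\<close>, so that \<open>Fract p q\<close> is $p/q$.
\<close>

definition rational_link :: "int \<Rightarrow> int \<Rightarrow> link set" where
  "rational_link p q =
     {numerator_closure T D | T D.
        rational_tangle T (Some (Fract p q)) \<and> orientation T D \<and>
        Bd NE \<in> D \<and> Bd NW \<notin> D \<and> Bd SW \<in> D \<and> Bd SE \<notin> D}"

text \<open>
  Sanity checks: every fraction is realised by a rational tangle, and for coprime \<open>p\<close>, \<open>q\<close> with
  \<open>p\<close> even the set \<open>rational_link p q\<close> is nonempty and consists of two-component diagrams.
\<close>

lemma linking_number_commute: "linking_number L A B = linking_number L B A"
  unfolding linking_number_def by (subst disj_commute) (rule refl)

lemma lk_eq: "components L = {A, B} \<Longrightarrow> A \<noteq> B \<Longrightarrow> lk L = linking_number L A B"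
  unfolding lk_def
proof (rule the_equality)
  fix l
  assume "components L = {A, B}"
    and "\<exists>A B. components L = {A, B} \<and> A \<noteq> B \<and> l = linking_number L A B"
  then obtain A' B' where "{A', B'} = {A, B}" "l = linking_number L A' B'"
    by metis
  then show "l = linking_number L A B"
    using linking_number_commute[of L A B] by (auto simp only: doubleton_eq_iff)
qed blast

definition tangle_step :: "tangle \<Rightarrow> (nat \<times> nat) set" where
  "tangle_step T = {(arc_at k c, arc_at k (opp c)) | k c. k \<in> set (crossings T)}"

text \<open>
  \<open>connects T m\<close>: the tangle \<open>T\<close> consists of two strands, without closed components, joining each
  end point \<open>c\<close> to \<open>m c\<close>, and they can be oriented independently of each other.
\<close>

definition connects :: "tangle \<Rightarrow> (corner \<Rightarrow> corner) \<Rightarrow> bool" where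
  "connects T m \<longleftrightarrow>
     (\<forall>X. (\<forall>c. c \<in> X \<longleftrightarrow> m c \<notin> X) \<longrightarrow>
        (\<exists>D. orientation T D \<and> (\<forall>c. Bd c \<in> D \<longleftrightarrow> c \<in> X))) \<and>
     (\<forall>a \<in> arcs T. \<exists>c. (a, ends T c) \<in> (tangle_step T)\<^sup>*) \<and>
     (\<forall>c. (ends T c, ends T (m c)) \<in> (tangle_step T)\<^sup>*) \<and>
     (\<exists>f :: nat \<Rightarrow> bool. (\<forall>(a, b) \<in> tangle_step T. f a = f b) \<and>
        (\<forall>c c'. f (ends T c) = f (ends T c') \<longleftrightarrow> c' = c \<or> c' = m c))"

text \<open>
  Both twists have the form \<open>attach\<close>: the corners \<open>u\<close>, \<open>v\<close> of the new crossing are glued to the end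
  points \<open>e\<close>, \<open>f\<close>.
\<close>

definition attach :: "slope \<Rightarrow> corner \<Rightarrow> corner \<Rightarrow> corner \<Rightarrow> corner \<Rightarrow> nat \<Rightarrow> nat \<Rightarrow> tangle \<Rightarrow> tangle" where
  "attach s u v e f x y T =
     \<lparr>crossings = crossings T @
        [\<lparr>over_slope = s,
          arc_at = (\<lambda>c. if c = u then ends T e else if c = v then ends T f
                        else if c = opp v then x else y)\<rparr>],
      ends = (ends T)(e := x, f := y)\<rparr>"

definition swap :: "corner \<Rightarrow> corner \<Rightarrow> corner \<Rightarrow> corner" where
  "swap e f c = (if c = e then f else if c = f then e else c)"

lemma horizontal_attach: "horizontal_twist s x y T = attach s NW SW NE SE x y T"
  unfolding horizontal_twist_def attach_def by (auto simp: fun_eq_iff split: corner.split)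

lemma vertical_attach: "vertical_twist s x y T = attach s NW NE SW SE x y T"
  unfolding vertical_twist_def attach_def by (auto simp: fun_eq_iff split: corner.split)

lemma opp_opp [simp]: "opp (opp c) = c"
  by (cases c) auto

lemma opp_neq [simp]: "opp c \<noteq> c" "c \<noteq> opp c"
  by (cases c; simp)+

lemma opp_eq_iff [simp]: "opp c = opp d \<longleftrightarrow> c = d"
  by (metis opp_opp)

lemma four_corners:
  assumes "u \<noteq> v" "v \<noteq> opp u"
  shows "c = u \<or> c = v \<or> c = opp u \<or> c = opp v"
  using assms by (cases c; cases u; cases v; simp)

lemma attach_ends: "ends (attach s u v e f x y T) = (ends T)(e := x, f := y)"
  by (simp add: attach_def)

lemma tangle_step_Union:
  "tangle_step T = (\<Union>k \<in> set (crossings T). range (\<lambda>c. (arc_at k c, arc_at k (opp c))))"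
  unfolding tangle_step_def by blast

lemma strand_step_Union:
  "strand_step L =
     (\<Union>k \<in> set (link_crossings L). range (\<lambda>c. (arc_at k c, arc_at k (opp c))))"
  unfolding strand_step_def by blast

lemma attach_step:
  assumes "u \<noteq> v" "v \<noteq> opp u"
  shows "tangle_step (attach s u v e f x y T) =
    tangle_step T \<union> {(ends T e, y), (y, ends T e), (ends T f, x), (x, ends T f)}"
proof -
  let ?a = "\<lambda>c. if c = u then ends T e else if c = v then ends T f
                        else if c = opp v then x else y"
  have "tangle_step (attach s u v e f x y T) = tangle_step T \<union> range (\<lambda>c. (?a c, ?a (opp c)))"
    by (simp add: tangle_step_Union attach_def Un_commute)
  also have "range (\<lambda>c. (?a c, ?a (opp c))) = (\<lambda>c. (?a c, ?a (opp c))) ` {u, v, opp u, opp v}"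
    by (rule arg_cong[where f = "image _"]) (use four_corners[OF assms] in blast)
  also have "\<dots> = {(ends T e, y), (ends T f, x), (y, ends T e), (x, ends T f)}"
  proof -
    have "v \<noteq> u" "opp u \<noteq> v" "opp v \<noteq> u" "u \<noteq> opp v"
      using assms by auto
    then show ?thesis
      using assms by (simp only: image_insert image_empty opp_opp opp_neq opp_eq_iff if_True if_False simp_thms)
  qed
  also have "\<dots> = {(ends T e, y), (y, ends T e), (ends T f, x), (x, ends T f)}"
    by (simp only: insert_commute)
  finally show ?thesis .
qed

lemma attach_orientation:
  assumes uv: "u \<noteq> v" "v \<noteq> opp u" and ef: "e \<noteq> f"
    and xy: "x \<notin> arcs T" "y \<notin> arcs T" "x \<noteq> y"
    and D: "orientation T D" "\<And>c. Bd c \<in> D \<longleftrightarrow> swap e f c \<in> X"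
  shows "\<exists>D'. orientation (attach s u v e f x y T) D' \<and> (\<forall>c. Bd c \<in> D' \<longleftrightarrow> c \<in> X)"
proof -
  define n where "n = length (crossings T)"
  let ?T = "attach s u v e f x y T"
  define D' where "D' = Bd ` X \<union> {Cr i c | i c. i < n \<and> Cr i c \<in> D} \<union>
    {Cr n c | c. c = u \<and> Bd e \<in> D \<or> c = opp u \<and> Bd e \<notin> D \<or>
                 c = v \<and> Bd f \<in> D \<or> c = opp v \<and> Bd f \<notin> D}"
  have ouv: "opp v \<noteq> u" "opp u \<noteq> v"
    using uv by auto
  note four = four_corners[OF uv]
  have mem: "\<And>c. Bd c \<in> D' \<longleftrightarrow> c \<in> X" "\<And>i c. i < n \<Longrightarrow> Cr i c \<in> D' \<longleftrightarrow> Cr i c \<in> D"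
    "Cr n u \<in> D' \<longleftrightarrow> Bd e \<in> D" "Cr n v \<in> D' \<longleftrightarrow> Bd f \<in> D"
    "Cr n (opp u) \<in> D' \<longleftrightarrow> Bd e \<notin> D" "Cr n (opp v) \<in> D' \<longleftrightarrow> Bd f \<notin> D"
    using uv ouv unfolding D'_def by auto
  define \<phi> where "\<phi> p = (if p = Cr n u then Bd e else if p = Cr n v then Bd f else p)" for p
  define Q where "Q = {Bd e, Bd f, Cr n (opp u), Cr n (opp v)}"
  have old: "\<phi> p \<in> ports T \<and> port_arc ?T p = port_arc T (\<phi> p) \<and> (p \<in> D' \<longleftrightarrow> \<phi> p \<in> D)"
    if p: "p \<in> ports ?T" "p \<notin> Q" for p
  proof (cases p)
    case (Bd c)
    then show ?thesis
      using p D(2)[of c] by (auto simp: Q_def \<phi>_def ports_def mem attach_def swap_def)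
  next
    case (Cr i c)
    then have "i < n \<or> i = n"
      using p by (auto simp: ports_def attach_def n_def)
    then show ?thesis
    proof
      assume i: "i < n"
      then show ?thesis
        using Cr by (auto simp: \<phi>_def ports_def mem attach_def nth_append n_def)
    next
      assume i: "i = n"
      then have "c = u \<or> c = v"
        using four[of c] p Cr by (auto simp: Q_def)
      then show ?thesis
        using Cr i uv ouv by (auto simp: \<phi>_def ports_def mem attach_def nth_append n_def[symmetric])
    qed
  qed
  have inj: "p = p'" if "\<phi> p = \<phi> p'" "p \<notin> Q" "p' \<notin> Q" for p p'
    using that ef by (auto simp: \<phi>_def Q_def split: if_splits)
  have new: "port_arc ?T (Bd e) = x" "port_arc ?T (Bd f) = y"
    "port_arc ?T (Cr n (opp u)) = y" "port_arc ?T (Cr n (opp v)) = x"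
    using ef uv ouv by (auto simp: attach_def n_def)
  have newD: "Bd e \<in> D' \<longleftrightarrow> Cr n (opp v) \<notin> D'" "Bd f \<in> D' \<longleftrightarrow> Cr n (opp u) \<notin> D'"
    using D(2)[of e] D(2)[of f] ef by (auto simp: mem swap_def)
  have oldarc: "port_arc T p \<in> arcs T" if "p \<in> ports T" for p
    using that nth_mem by (fastforce simp: ports_def arcs_def)
  have "orientation ?T D'"
    unfolding orientation_def
  proof (intro conjI allI impI ballI)
    have "D \<subseteq> ports T"
      using D(1) by (simp add: orientation_def)
    then show "D' \<subseteq> ports ?T"
      by (auto simp: D'_def ports_def attach_def n_def)
  next
    fix i c
    assume "i < length (crossings ?T)"
    then have "i < n \<or> i = n"
      by (auto simp: attach_def n_def)
    then show "Cr i c \<in> D' \<longleftrightarrow> Cr i (opp c) \<notin> D'"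
    proof
      assume "i < n"
      then show ?thesis
        using D(1) mem(2) unfolding orientation_def n_def[symmetric] by blast
    next
      assume "i = n"
      then show ?thesis
        using four[of c] by (elim disjE) (simp_all only: mem opp_opp not_not)
    qed
  next
    fix p p'
    assume p: "p \<in> ports ?T" and p': "p' \<in> ports ?T"
      and *: "p \<noteq> p' \<and> port_arc ?T p = port_arc ?T p'"
    show "p \<in> D' \<longleftrightarrow> p' \<notin> D'"
    proof (cases "p \<in> Q \<or> p' \<in> Q")
      case True
      have Qxy: "port_arc ?T r \<in> {x, y}" if "r \<in> Q" for r
        using that new unfolding Q_def by blast
      have Qxy': "port_arc ?T r \<notin> {x, y}" if "r \<in> ports ?T" "r \<notin> Q" for r
        using old[OF that] oldarc[of "\<phi> r"] xy(1,2) by (metis insertE singletonD)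
      have "p \<in> Q" "p' \<in> Q"
        using True Qxy Qxy' p p' * by metis+
      then have "p = Bd e \<or> p = Bd f \<or> p = Cr n (opp u) \<or> p = Cr n (opp v)"
        "p' = Bd e \<or> p' = Bd f \<or> p' = Cr n (opp u) \<or> p' = Cr n (opp v)"
        unfolding Q_def by blast+
      then show ?thesis
        using * new newD xy(3) by metis
    next
      case False
      then have "\<phi> p \<noteq> \<phi> p'"
        using inj * by blast
      then show ?thesis
        using old[OF p] old[OF p'] False * D(1) unfolding orientation_def by metis
    qed
  qed
  then show ?thesis
    using mem(1) by blast
qed

lemma attach_connects:
  assumes uv: "u \<noteq> v" "v \<noteq> opp u" and ef: "e \<noteq> f"
    and xy: "x \<notin> arcs T" "y \<notin> arcs T" "x \<noteq> y"
    and T: "connects T m"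
  shows "connects (attach s u v e f x y T) (swap e f \<circ> m \<circ> swap e f)"
proof -
  let ?T = "attach s u v e f x y T"
  let ?m = "swap e f \<circ> m \<circ> swap e f"
  have sw: "swap e f (swap e f c) = c" for c
    by (auto simp: swap_def)
  note step = attach_step[OF uv, of s e f x y T]
  have mono: "(tangle_step T)\<^sup>* \<subseteq> (tangle_step ?T)\<^sup>*"
    by (rule rtrancl_mono) (auto simp: step)
  have new: "(ends ?T c, ends T (swap e f c)) \<in> (tangle_step ?T)\<^sup>*"
            "(ends T c, ends ?T (swap e f c)) \<in> (tangle_step ?T)\<^sup>*" for c
    using ef by (auto simp: step attach_ends swap_def)
  have h1: "\<exists>D. orientation ?T D \<and> (\<forall>c. Bd c \<in> D \<longleftrightarrow> c \<in> X)"
    if X: "\<forall>c. c \<in> X \<longleftrightarrow> ?m c \<notin> X" for X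
  proof -
    let ?X = "{c. swap e f c \<in> X}"
    have "\<forall>c. c \<in> ?X \<longleftrightarrow> m c \<notin> ?X"
      using X sw by (metis comp_apply mem_Collect_eq)
    then obtain D where D: "orientation T D" "\<forall>c. Bd c \<in> D \<longleftrightarrow> c \<in> ?X"
      using T unfolding connects_def by meson
    then show ?thesis
      using attach_orientation[OF uv ef xy D(1), of X s] by simp
  qed
  have h2: "\<exists>c. (a, ends ?T c) \<in> (tangle_step ?T)\<^sup>*" if "a \<in> arcs ?T" for a
  proof -
    have "a \<in> arcs T \<or> a = ends ?T e \<or> a = ends ?T f"
      using that ef by (auto simp: arcs_def attach_def split: if_splits)
    moreover have ?thesis if a: "a \<in> arcs T"
    proof -
      obtain c where "(a, ends T c) \<in> (tangle_step T)\<^sup>*"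
        using T a unfolding connects_def by meson
      then show ?thesis
        using mono new(2)[of c] by (meson rtrancl_trans subsetD)
    qed
    ultimately show ?thesis
      by blast
  qed
  have h3: "(ends ?T c, ends ?T (?m c)) \<in> (tangle_step ?T)\<^sup>*" for c
  proof -
    have "(ends T (swap e f c), ends T (m (swap e f c))) \<in> (tangle_step T)\<^sup>*"
      using T unfolding connects_def by blast
    then have "(ends T (swap e f c), ends T (m (swap e f c))) \<in> (tangle_step ?T)\<^sup>*"
      using mono by blast
    from rtrancl_trans[OF rtrancl_trans[OF new(1) this] new(2)] show ?thesis
      by simp
  qed
  have h4: "\<exists>g :: nat \<Rightarrow> bool. (\<forall>(a, b) \<in> tangle_step ?T. g a = g b) \<and>
        (\<forall>c c'. g (ends ?T c) = g (ends ?T c') \<longleftrightarrow> c' = c \<or> c' = ?m c)"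
  proof -
    obtain g :: "nat \<Rightarrow> bool" where g: "\<forall>(a, b) \<in> tangle_step T. g a = g b"
        "\<And>c c'. g (ends T c) = g (ends T c') \<longleftrightarrow> c' = c \<or> c' = m c"
      using T unfolding connects_def by blast
    let ?g = "g(x := g (ends T f), y := g (ends T e))"
    have ne: "ends T c \<noteq> x" "ends T c \<noteq> y" for c
      using xy by (auto simp: arcs_def)
    have ne': "a \<noteq> x" "a \<noteq> y" "b \<noteq> x" "b \<noteq> y" if "(a, b) \<in> tangle_step T" for a b
    proof -
      have "{a, b} \<subseteq> arcs T"
        using that by (auto simp: arcs_def tangle_step_def)
      then show "a \<noteq> x" "a \<noteq> y" "b \<noteq> x" "b \<noteq> y"
        using xy by auto
    qed
    then have old: "?g a = ?g b" if "(a, b) \<in> tangle_step T" for a b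
    proof -
      have "g a = g b"
        using g(1) that by blast
      then show ?thesis
        using ne'[OF that] by simp
    qed
    have 1: "\<forall>(a, b) \<in> tangle_step ?T. ?g a = ?g b"
    proof (clarify, goal_cases)
      case (1 a b)
      then consider "(a, b) \<in> tangle_step T" | "a = ends T e" "b = y" | "a = y" "b = ends T e"
        | "a = ends T f" "b = x" | "a = x" "b = ends T f"
        unfolding step by blast
      then show ?case
        using old ne xy(3) by cases auto
    qed
    have 2: "?g (ends ?T c) = g (ends T (swap e f c))" for c
      using ne ef xy(3) by (auto simp: attach_def swap_def)
    have 3: "?g (ends ?T c) = ?g (ends ?T c') \<longleftrightarrow> c' = c \<or> c' = ?m c" for c c'
    proof -
      have "swap e f c' = d \<longleftrightarrow> c' = swap e f d" for d
        using sw by metis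
      then show ?thesis
        unfolding 2 g(2) by (simp add: sw)
    qed
    show ?thesis
      using 1 3 by blast
  qed
  show ?thesis
    unfolding connects_def
  proof (intro conjI)
    show "\<forall>X. (\<forall>c. c \<in> X \<longleftrightarrow> ?m c \<notin> X) \<longrightarrow>
        (\<exists>D. orientation ?T D \<and> (\<forall>c. Bd c \<in> D \<longleftrightarrow> c \<in> X))"
      using h1 by fast
    show "\<forall>a \<in> arcs ?T. \<exists>c. (a, ends ?T c) \<in> (tangle_step ?T)\<^sup>*"
      using h2 by fast
    show "\<forall>c. (ends ?T c, ends ?T (?m c)) \<in> (tangle_step ?T)\<^sup>*"
      by (rule allI, rule h3)
  qed (rule h4)
qed

text \<open>The end point to which \<open>c\<close> is joined, by the parities of \<open>p\<close> and \<open>q\<close>.\<close>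

definition mate :: "int \<Rightarrow> int \<Rightarrow> corner \<Rightarrow> corner" where
  "mate p q c =
     (if even p then (case c of NW \<Rightarrow> NE | NE \<Rightarrow> NW | SW \<Rightarrow> SE | SE \<Rightarrow> SW)
      else if even q then (case c of NW \<Rightarrow> SW | SW \<Rightarrow> NW | NE \<Rightarrow> SE | SE \<Rightarrow> NE)
      else opp c)"

definition fraction :: "int \<Rightarrow> int \<Rightarrow> rat option" where
  "fraction p q = (if q = 0 then None else Some (Fract p q))"

fun slope_int :: "slope \<Rightarrow> int" where
  "slope_int Pos = 1" | "slope_int Neg = -1"

lemma ext_add_frac: "ext_add (fraction p q) (twist_sign s) = fraction (p + slope_int s * q) q"
  by (cases s) (auto simp: fraction_def ext_add_def One_rat_def)

lemma ext_inverse_frac: "coprime p q \<Longrightarrow> ext_inverse (fraction p q) = fraction q p"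
proof -
  assume "coprime p q"
  then have "q = 0 \<Longrightarrow> p \<noteq> 0"
    by auto
  moreover have "q \<noteq> 0 \<Longrightarrow> Fract p q = 0 \<longleftrightarrow> p = 0"
    unfolding Zero_rat_def by (simp add: eq_rat)
  ultimately show ?thesis
    by (auto simp: fraction_def rat_number_collapse)
qed

lemma coprime_add_slope: "coprime p q \<Longrightarrow> coprime (p + slope_int s * q) q" for p q :: int
  by (cases s) (auto simp: coprime_iff_gcd_eq_1 gcd_diff1)

lemma mate_horizontal:
  "coprime p q \<Longrightarrow> swap NE SE \<circ> mate p q \<circ> swap NE SE = mate (p + slope_int s * q) q"
  by (cases s; rule ext; rename_tac c; case_tac c)
    (auto simp: mate_def swap_def)

lemma mate_vertical:
  "coprime p q \<Longrightarrow> swap SW SE \<circ> mate p q \<circ> swap SW SE = mate p (q + slope_int s * p)"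
  by (cases s; rule ext; rename_tac c; case_tac c)
    (auto simp: mate_def swap_def)

lemma trivial_connects:
  assumes "x \<noteq> y"
  shows "connects (trivial_tangle x y) (mate 0 1)"
proof -
  let ?T = "trivial_tangle x y"
  have orient: "\<exists>D. orientation ?T D \<and> (\<forall>c. Bd c \<in> D \<longleftrightarrow> c \<in> X)"
    if X: "\<forall>c. c \<in> X \<longleftrightarrow> mate 0 1 c \<notin> X" for X
  proof (intro exI conjI)
    show "orientation ?T (Bd ` X)"
      using assms X[rule_format, of NW] X[rule_format, of SW]
      unfolding orientation_def
      by (auto simp: ports_def trivial_tangle_def mate_def image_iff split: corner.splits)
  qed auto
  have f: "\<exists>f :: nat \<Rightarrow> bool. \<forall>c c'. f (ends ?T c) = f (ends ?T c') \<longleftrightarrow> c' = c \<or> c' = mate 0 1 c"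
    by (rule exI[of _ "\<lambda>a. a = x"])
      (use assms in \<open>auto simp: trivial_tangle_def mate_def split: corner.splits\<close>)
  have arcs: "\<forall>a \<in> arcs ?T. \<exists>c. (a, ends ?T c) \<in> (tangle_step ?T)\<^sup>*"
    by (auto simp: arcs_def trivial_tangle_def)
  have m: "\<forall>c. ends ?T c = ends ?T (mate 0 1 c)"
    by (auto simp: trivial_tangle_def mate_def split: corner.splits)
  have step: "tangle_step ?T = {}"
    by (simp add: tangle_step_def trivial_tangle_def)
  show ?thesis
    unfolding connects_def
  proof (intro conjI)
    show "\<forall>X. (\<forall>c. c \<in> X \<longleftrightarrow> mate 0 1 c \<notin> X) \<longrightarrow>
        (\<exists>D. orientation ?T D \<and> (\<forall>c. Bd c \<in> D \<longleftrightarrow> c \<in> X))"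
      using orient by fast
    show "\<forall>c. (ends ?T c, ends ?T (mate 0 1 c)) \<in> (tangle_step ?T)\<^sup>*"
      using m by (metis rtrancl.rtrancl_refl)
    show "\<exists>f :: nat \<Rightarrow> bool. (\<forall>(a, b) \<in> tangle_step ?T. f a = f b) \<and>
        (\<forall>c c'. f (ends ?T c) = f (ends ?T c') \<longleftrightarrow> c' = c \<or> c' = mate 0 1 c)"
      unfolding step using f by simp
  qed (rule arcs)
qed

lemma rational_tangle_connects:
  "rational_tangle T F \<Longrightarrow> \<exists>p q. coprime p q \<and> F = fraction p q \<and> connects T (mate p q)"
proof (induction rule: rational_tangle.induct)
  case (trivial x y)
  then show ?case
    using trivial_connects[of x y] by (intro exI[of _ 0] exI[of _ 1]) (auto simp: fraction_def Zero_rat_def)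
next
  case (horizontal T F x y s)
  then obtain p q where pq: "coprime p q" "F = fraction p q" "connects T (mate p q)"
    by blast
  have "connects (horizontal_twist s x y T) (swap NE SE \<circ> mate p q \<circ> swap NE SE)"
    unfolding horizontal_attach by (rule attach_connects) (use horizontal pq in auto)
  then show ?case
    using pq ext_add_frac coprime_add_slope mate_horizontal by metis
next
  case (vertical T F x y s)
  then obtain p q where pq: "coprime p q" "F = fraction p q" "connects T (mate p q)"
    by blast
  have "connects (vertical_twist s x y T) (swap SW SE \<circ> mate p q \<circ> swap SW SE)"
    unfolding vertical_attach by (rule attach_connects) (use vertical pq in auto)
  moreover have "coprime p (q + slope_int s * p)" "coprime (q + slope_int s * p) p"
    using coprime_add_slope[of q p s] pq(1) by (simp_all add: ac_simps)
  ultimately show ?case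
    using pq ext_add_frac ext_inverse_frac mate_vertical coprime_commute by metis
qed

lemma even_numerator:
  assumes "coprime p q" "even p" "coprime p' q'" "Some (Fract p q) = fraction p' q'"
  shows "even p'"
proof -
  have "odd q"
    using assms(1,2) by (meson coprime_common_divisor odd_one)
  then have "q \<noteq> 0"
    by auto
  then have eq: "p * q' = p' * q"
    using assms(4) by (auto simp: fraction_def eq_rat split: if_splits)
  show ?thesis
    using \<open>odd q\<close> eq assms(2) by (metis even_mult_iff)
qed

lemma finite_arcs: "finite (arcs T)"
proof -
  have "(UNIV :: corner set) = {NW, NE, SW, SE}"
    using corner.exhaust by auto
  then have "finite (UNIV :: corner set)"
    by (metis finite.emptyI finite_insert)
  then show ?thesis
    by (auto simp: arcs_def)
qed

lemma fresh: "\<exists>x y. x \<notin> arcs T \<and> y \<notin> arcs T \<and> x \<noteq> y"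
  by (metis ex_new_if_finite finite_arcs finite_insert infinite_UNIV_nat insert_iff)

lemma twist_h:
  "\<exists>T. rational_tangle T (fraction p q) \<Longrightarrow> \<exists>T. rational_tangle T (fraction (p + slope_int s * q) q)"
  using rational_tangle.horizontal fresh ext_add_frac by metis

lemma twist_v:
  assumes "coprime p q" "\<exists>T. rational_tangle T (fraction p q)"
  shows "\<exists>T. rational_tangle T (fraction p (q + slope_int s * p))"
proof -
  have "coprime (q + slope_int s * p) p"
    using coprime_add_slope[of q p s] assms(1) by (simp add: ac_simps)
  then show ?thesis
    using rational_tangle.vertical fresh ext_add_frac ext_inverse_frac assms coprime_commute
    by metis
qed

lemma rational_tangle_exists:
  "coprime p q \<Longrightarrow> \<exists>T. rational_tangle T (fraction p q)"
proof (induction "nat (\<bar>p\<bar> + \<bar>q\<bar>)" arbitrary: p q rule: less_induct)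
  case less
  have zero: "\<exists>T. rational_tangle T (fraction 0 r)" if "r \<noteq> 0" for r
    using rational_tangle.trivial[of 0 1] that by (auto simp: fraction_def rat_number_collapse)
  consider "p = 0" | "q = 0" | "p \<noteq> 0" "q \<noteq> 0" "\<bar>q\<bar> \<le> \<bar>p\<bar>" | "p \<noteq> 0" "q \<noteq> 0" "\<bar>p\<bar> < \<bar>q\<bar>"
    by linarith
  then show ?case
  proof cases
    case 1
    then show ?thesis
      using zero[of q] less.prems by auto
  next
    case 2
    have "\<exists>T. rational_tangle T (fraction 1 1)"
      using twist_h[OF zero[of 1], of Pos] by simp
    then have "\<exists>T. rational_tangle T (fraction 1 0)"
      using twist_v[of 1 1 Neg] by simp
    then show ?thesis
      using 2 by (simp add: fraction_def)
  next
    case 3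
    define s where "s = (if (p > 0) = (q > 0) then Pos else Neg)"
    have lt: "\<bar>p - slope_int s * q\<bar> < \<bar>p\<bar>"
      using 3 by (auto simp: s_def)
    have "coprime (p - slope_int s * q) q"
      using coprime_add_slope[OF less.prems, of Pos] coprime_add_slope[OF less.prems, of Neg]
      by (cases s) auto
    then have "\<exists>T. rational_tangle T (fraction (p - slope_int s * q) q)"
      using less.hyps lt by simp
    then show ?thesis
      using twist_h[of "p - slope_int s * q" q s] by simp
  next
    case 4
    define s where "s = (if (p > 0) = (q > 0) then Pos else Neg)"
    have lt: "\<bar>q - slope_int s * p\<bar> < \<bar>q\<bar>"
      using 4 by (auto simp: s_def)
    have "coprime q p"
      using less.prems by (simp add: ac_simps)
    then have cp: "coprime p (q - slope_int s * p)"
      using coprime_add_slope[of q p Pos] coprime_add_slope[of q p Neg]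
      by (cases s) (auto simp: ac_simps)
    then have "\<exists>T. rational_tangle T (fraction p (q - slope_int s * p))"
      using less.hyps lt by simp
    then show ?thesis
      using twist_v[OF cp, of s] by simp
  qed
qed

lemma rational_link_nonempty:
  assumes "coprime p q" "even p"
  shows "rational_link p q \<noteq> {}"
proof -
  have "q \<noteq> 0"
    using assms by (metis coprime_common_divisor dvd_0_right odd_one)
  then obtain T where T: "rational_tangle T (Some (Fract p q))"
    using rational_tangle_exists[OF assms(1)] by (auto simp: fraction_def)
  then obtain p' q' where p': "coprime p' q'" "Some (Fract p q) = fraction p' q'" "connects T (mate p' q')"
    using rational_tangle_connects by blast
  then have "even p'"
    using even_numerator assms by blast
  then have "\<forall>c. c \<in> {NE, SW} \<longleftrightarrow> mate p' q' c \<notin> {NE, SW}"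
    by (auto simp: mate_def split: corner.splits)
  then obtain D where "orientation T D" "\<forall>c. Bd c \<in> D \<longleftrightarrow> c \<in> {NE, SW}"
    using p'(3) unfolding connects_def by meson
  then show ?thesis
    using T by (auto simp: rational_link_def)
qed

lemma rational_link_components:
  assumes "coprime p q" "even p" "L \<in> rational_link p q"
  shows "\<exists>A B. components L = {A, B} \<and> A \<noteq> B"
proof -
  obtain T D where L: "L = numerator_closure T D" and T: "rational_tangle T (Some (Fract p q))"
    using assms(3) by (auto simp: rational_link_def)
  then obtain p' q' where p': "coprime p' q'" "Some (Fract p q) = fraction p' q'" "connects T (mate p' q')"
    using rational_tangle_connects by blast
  then have ev: "even p'"
    using even_numerator assms by blast
  obtain g :: "nat \<Rightarrow> bool" where g: "\<forall>(a, b) \<in> tangle_step T. g a = g b"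
      "\<And>c c'. g (ends T c) = g (ends T c') \<longleftrightarrow> c' = c \<or> c' = mate p' q' c"
    using p'(3) unfolding connects_def by blast
  have gNS: "g (ends T NE) = g (ends T NW)" "g (ends T SE) = g (ends T SW)"
      "g (ends T NW) \<noteq> g (ends T SW)"
    using ev by (auto simp: g(2) mate_def)
  define \<rho> where "\<rho> = closure_arc T"
  have g_merge: "g (merge x y a) = g a" if "g x = g y" for x y a
    using that by (simp add: merge_def)
  have g\<rho>: "g (\<rho> a) = g a" for a
    using gNS(1,2) by (simp only: \<rho>_def closure_arc_def Let_def comp_apply g_merge)
  have \<rho>: "\<rho> (ends T NE) = \<rho> (ends T NW)" "\<rho> (ends T SE) = \<rho> (ends T SW)"
    by (simp_all add: \<rho>_def closure_arc_def merge_def Let_def)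
  let ?R = "(strand_step L)\<^sup>*"
  have stepL: "strand_step L = (\<lambda>(a, b). (\<rho> a, \<rho> b)) ` tangle_step T"
    by (simp add: strand_step_Union tangle_step_Union L numerator_closure_def \<rho>_def
        image_UN image_image)
  have lift: "(\<rho> a, \<rho> b) \<in> ?R" if "(a, b) \<in> (tangle_step T)\<^sup>*" for a b
    using that
  proof (induction rule: rtrancl_induct)
    case (step b c)
    then have "(\<rho> b, \<rho> c) \<in> strand_step L"
      by (auto simp: stepL)
    then show ?case
      using step.IH by simp
  qed simp
  have "sym (strand_step L)"
    by (rule symI) (auto simp: strand_step_def, metis opp_opp)
  then have symR: "sym ?R"
    by (rule sym_rtrancl)
  have gR: "g a = g b" if "(a, b) \<in> ?R" for a b
    using that
  proof (induction rule: rtrancl_induct)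
    case (step b c)
    then show ?case
      using g(1) by (auto simp: stepL g\<rho>)
  qed simp
  define A where "A = ?R `` {\<rho> (ends T NW)}"
  define B where "B = ?R `` {\<rho> (ends T SW)}"
  have cls: "?R `` {a} = ?R `` {b}" if "(a, b) \<in> ?R" for a b
    using that symR by (auto dest: symD intro: rtrancl_trans)
  have arcs: "?R `` {a} \<in> {A, B}" if a: "a \<in> link_arcs L" for a
  proof -
    obtain a' where a': "a' \<in> arcs T" "a = \<rho> a'"
      using a by (auto simp: L numerator_closure_def \<rho>_def)
    then obtain c where "(a', ends T c) \<in> (tangle_step T)\<^sup>*"
      using p'(3) unfolding connects_def by meson
    then have "?R `` {a} = ?R `` {\<rho> (ends T c)}"
      using lift cls a' by blast
    then show ?thesis
      using \<rho> by (cases c) (simp_all add: A_def B_def)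
  qed
  have NW: "\<rho> (ends T NW) \<in> link_arcs L" and SW: "\<rho> (ends T SW) \<in> link_arcs L"
    by (auto simp: L numerator_closure_def \<rho>_def arcs_def)
  have "components L = {A, B}"
    using arcs NW SW unfolding components_def quotient_def A_def B_def by blast
  moreover have "A \<noteq> B"
  proof
    assume "A = B"
    then have "(\<rho> (ends T SW), \<rho> (ends T NW)) \<in> ?R"
      unfolding A_def B_def by blast
    then show False
      using gR g\<rho> gNS(3) by metis
  qed
  ultimately show ?thesis
    by blast
qed

text \<open>The normalisation $lk(R_{2/1}) = 1$.\<close>

lemma lk_two: "\<exists>L \<in> rational_link 2 1. lk L = 1"
proof -
  define T where "T = horizontal_twist Pos 4 5 (horizontal_twist Pos 2 3 (trivial_tangle 0 1))"
  define D where "D = {Bd NE, Cr 1 SW, Cr 0 NW, Bd SW, Cr 0 NE, Cr 1 SE}"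
  define k0 where "k0 = \<lparr>over_slope = Pos,
    arc_at = (\<lambda>c. case c of NW \<Rightarrow> 0 | SW \<Rightarrow> 1 | NE \<Rightarrow> 2 | SE \<Rightarrow> 3)\<rparr>"
  define k1 where "k1 = \<lparr>over_slope = Pos,
    arc_at = (\<lambda>c. case c of NW \<Rightarrow> 2 | SW \<Rightarrow> 3 | NE \<Rightarrow> 4 | SE \<Rightarrow> 5)\<rparr>"
  have corners: "(UNIV :: corner set) = {NW, NE, SW, SE}"
    using corner.exhaust by auto
  have all: "(\<forall>c. P c) \<longleftrightarrow> P NW \<and> P NE \<and> P SW \<and> P SE" for P
    by (metis corner.exhaust)
  have T: "T = \<lparr>crossings = [k0, k1], ends = (\<lambda>c. case c of NW \<Rightarrow> 0 | SW \<Rightarrow> 1 | NE \<Rightarrow> 4 | SE \<Rightarrow> 5)\<rparr>"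
    by (auto simp: T_def horizontal_twist_def trivial_tangle_def k0_def k1_def fun_eq_iff
        split: corner.split)
  have "rational_tangle T (ext_add (ext_add (Some 0) (twist_sign Pos)) (twist_sign Pos))"
    unfolding T_def
    by (intro rational_tangle.intros)
      (simp_all add: arcs_def horizontal_twist_def trivial_tangle_def corners)
  then have rat: "rational_tangle T (Some (Fract 2 1))"
    by (simp add: ext_add_def rat_number_collapse)
  have ports: "ports T = {Bd NW, Bd NE, Bd SW, Bd SE, Cr 0 NW, Cr 0 NE, Cr 0 SW, Cr 0 SE,
      Cr 1 NW, Cr 1 NE, Cr 1 SW, Cr 1 SE}"
  proof -
    have "ports T = range Bd \<union> (range (Cr 0) \<union> range (Cr 1))"
      by (auto simp: ports_def T less_Suc_eq)
    then show ?thesis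
      by (simp only: corners image_insert image_empty Un_insert_left Un_empty_left)
  qed
  have "orientation T D"
    unfolding orientation_def ports
    by (simp add: T all less_Suc_eq k0_def k1_def D_def)
  then have mem: "numerator_closure T D \<in> rational_link 2 1"
    using rat unfolding rational_link_def by (auto simp: D_def)
  let ?L = "numerator_closure T D"
  have cl: "closure_arc T a = (if a = 4 then 0 else if a = 5 then 1 else a)" for a
    by (simp add: closure_arc_def merge_def T Let_def)
  have arcs: "link_arcs ?L = {0, 1, 2, 3}"
  proof -
    have "arcs T = {0, 1, 2, 3, 4, 5}"
      by (auto simp: arcs_def T corners k0_def k1_def)
    then show ?thesis
      by (auto simp: numerator_closure_def cl)
  qed
  have cr: "link_crossings ?L = [k0, k1\<lparr>arc_at := (\<lambda>c. case c of NW \<Rightarrow> 2 | SW \<Rightarrow> 3 | NE \<Rightarrow> 0 | SE \<Rightarrow> 1)\<rparr>]"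
  proof -
    have "crossings T = [k0, k1]"
      by (simp add: T)
    then show ?thesis
      by (auto simp: numerator_closure_def cl k0_def k1_def fun_eq_iff split: corner.split)
  qed
  have step: "strand_step ?L = {(0, 3), (3, 0), (1, 2), (2, 1)}"
    by (auto simp: strand_step_Union cr corners k0_def)
  have cls: "(strand_step ?L)\<^sup>* `` {a} = {a, b}"
    if ab: "(a, b) \<in> strand_step ?L" for a b
  proof -
    have "c \<in> {a, b}" if "(a, c) \<in> (strand_step ?L)\<^sup>*" for c
      using that by (induction rule: rtrancl_induct) (use ab in \<open>auto simp: step\<close>)
    then show ?thesis
      using ab by blast
  qed
  have comps: "components ?L = {{0, 3}, {1, 2}}"
    using cls[of 0 3] cls[of 3 0] cls[of 1 2] cls[of 2 1]
    by (simp add: components_def quotient_def arcs step insert_commute)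
  have exits: "exits ?L = {(1, SW), (0, NW), (0, NE), (1, SE)}"
    by (auto simp: numerator_closure_def D_def)
  have sign: "crossing_sign ?L i = 1" if "i < 2" for i
  proof -
    have "\<exists>c. c \<notin> over_corners (over_slope (link_crossings ?L ! i)) \<and>
        (i, c) \<in> exits ?L \<and> (i, clockwise c) \<in> exits ?L"
      using that by (intro exI[of _ "if i = 0 then NW else SE"])
        (auto simp: cr k0_def k1_def exits less_Suc_eq numeral_2_eq_2)
    then show ?thesis
      by (simp add: crossing_sign_def)
  qed
  have "crosses_over (link_crossings ?L ! 0) {1, 2} {0, 3}"
    "crosses_over (link_crossings ?L ! 1) {0, 3} {1, 2}"
    by (simp_all add: cr crosses_over_def all k0_def k1_def)
  moreover have "i < length (link_crossings ?L) \<longleftrightarrow> i = 0 \<or> i = 1" for i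
    by (auto simp: cr)
  ultimately have "{i. i < length (link_crossings ?L) \<and>
          (crosses_over (link_crossings ?L ! i) {0, 3} {1, 2} \<or>
           crosses_over (link_crossings ?L ! i) {1, 2} {0, 3})} = {0, 1}"
    by blast
  then have "linking_number ?L {0, 3} {1, 2} = 1"
    by (simp add: linking_number_def sign)
  moreover have "{0, 3} \<noteq> {1, 2 :: nat}"
    by auto
  ultimately show ?thesis
    using mem lk_eq[OF comps] by auto
qed

end

theory Submission
  imports Defs
begin

text \<open>
  The linking number of the closure is half the signed number of crossings between the two strands
  of the tangle, and this count can be followed along the twists that build the tangle. Strands
  are oriented by a convention that depends on the parities of $p$ and $q$: if $p$ is even, both
  strands enter at NE and SW, as in $R_{p/q}$; otherwise both enter at SE and SW. Reversing one
  strand negates the count.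

  A horizontal twist twists the ends NE and SE. If $q$ is even these are the two ends of one strand:
  the new crossing is a self-crossing and contributes nothing, but the ends of that strand are
  exchanged, so the conventional orientation is now the opposite one and the count is negated. If
  $q$ is odd the ends belong to different strands, the convention is preserved, and the new crossing
  has the sign of the twist. Vertical twists behave in the same way with $p$ in the role of $q$.
  The count $c$ of a tangle of fraction $p/q$ therefore starts with $c(0, 1) = 0$ and obeys

  \<^item> $c(p \<pm> q, q) = -c(p, q)$ for even $q$ and $c(p, q) \<pm> 1$ for odd $q$,
  \<^item> $c(p, q \<pm> p) = -c(p, q)$ for even $p$ and $c(p, q) \<pm> 1$ for odd $p$.

  A fraction is reached by many sequences of twists, so these rules make $c$ a function of the
  fraction only if they are consistent. They are: \<open>linking_count\<close> is defined by the subtractive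
  Euclidean algorithm, which uses only positive twists of nonnegative fractions, and by mirror
  images for negative ones; the lemmas \<open>linking_count_horizontal\<close> and \<open>linking_count_vertical\<close>
  show that it satisfies both rules for all $p$, $q$ and both signs. By induction on the
  twists (\<open>rational_tangle_counted_by\<close>) every diagram of a rational
  $p/q$-tangle has the count \<open>linking_count p q\<close>, whence $lk(R_{p/q})$ is half of it. For $p$ even
  and $q$ odd the claims then say that the unlink has count $0$, that mirroring
  negates the count, that two horizontal twists add $2$, and that a vertical twist negates it.
\<close>

section \<open>The signed crossing count of a fraction\<close>

text \<open>
  The count for nonnegative fractions: $p/q$ arises by a positive horizontal twist from
  $(p - q)/q$ if $q \<le> p$, and by a positive vertical twist from $p/(q - p)$ if $p \<le> q$. At $p = q$
  both apply, to a fraction $0$ and to $\<infinity>$ respectively, and they give the same value.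
\<close>

function euclid_count :: "nat \<Rightarrow> nat \<Rightarrow> int" where
  "euclid_count p q =
     (if p = 0 \<or> q = 0 then 0
      else if q \<le> p then (if even q then - euclid_count (p - q) q else euclid_count (p - q) q + 1)
      else (if even p then - euclid_count p (q - p) else euclid_count p (q - p) + 1))"
  by auto
termination
  by (relation "measure (\<lambda>(p, q). p + q)") auto

declare euclid_count.simps [simp del]

lemma euclid_count_0 [simp]: "euclid_count 0 q = 0" "euclid_count p 0 = 0"
  by (simp_all add: euclid_count.simps)

text \<open>
  The two rules are exchanged by swapping $p$ and $q$, which corresponds to reflecting tangles in
  the diagonal through NW and SE.
\<close>

lemma euclid_count_commute: "euclid_count p q = euclid_count q p"
proof (induction p q rule: euclid_count.induct)
  case (1 p q)
  show ?case
  proof (cases "p = 0 \<or> q = 0 \<or> p = q")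
    case False
    then show ?thesis
      using 1 by (subst (1 2) euclid_count.simps) auto
  qed auto
qed

lemma euclid_count_add_left:
  "euclid_count (p + q) q = (if even q then - euclid_count p q else euclid_count p q + 1)"
  by (subst euclid_count.simps) auto

lemma euclid_count_add_right:
  "euclid_count p (p + q) = (if even p then - euclid_count p q else euclid_count p q + 1)"
  using euclid_count_add_left[of q p] by (simp add: euclid_count_commute add.commute)

text \<open>Tangles of opposite fractions are mirror images, so their counts are opposite.\<close>

definition linking_count :: "int \<Rightarrow> int \<Rightarrow> int" where
  "linking_count p q =
     (if p * q < 0 then - euclid_count (nat \<bar>p\<bar>) (nat \<bar>q\<bar>) else euclid_count (nat \<bar>p\<bar>) (nat \<bar>q\<bar>))"

lemma linking_count_commute: "linking_count p q = linking_count q p"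
  by (simp add: linking_count_def euclid_count_commute mult.commute)

lemma linking_count_minus_left: "linking_count (- p) q = - linking_count p q"
proof (cases "p = 0 \<or> q = 0")
  case False
  then have "p * q \<noteq> 0"
    by simp
  then show ?thesis
    by (auto simp: linking_count_def)
qed (auto simp: linking_count_def)

lemma linking_count_minus_right: "linking_count p (- q) = - linking_count p q"
  using linking_count_minus_left[of q p] by (simp add: linking_count_commute)

text \<open>
  The consistency of the rules. For $p/q \<ge> 0$ and for $p/q \<le> -1$ (mirrored) the claim is the recursion
  itself. The remaining fractions are those that the twist moves across zero, say
  $p/q = -a/(a + c)$ and $(p + q)/q = c/(a + c)$. Both are then reached by a vertical twist,
  negative from $-a/c$ and positive from $c/a$; since the counts of $-a/c$ and $c/a$ are
  opposite by symmetry, the claim reduces to comparing parities.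
\<close>

lemma linking_count_add_left:
  "linking_count (p + q) q = (if even q then - linking_count p q else linking_count p q + 1)"
proof -
  have nonneg: "linking_count (p + q) q = (if even q then - linking_count p q else linking_count p q + 1)"
    if q: "q \<ge> 0" for p q
  proof -
    obtain b where b: "q = int b"
      using q nonneg_int_cases by blast
    consider a where "p = int a" | a where "p + q = - int a"
      | a c where "p = - int a" "p + q = int c" "a > 0" "c > 0"
    proof -
      have "p \<ge> 0 \<or> p + q \<le> 0 \<or> p < 0 \<and> p + q > 0"
        by linarith
      then show thesis
        using that(1)[of "nat p"] that(2)[of "nat (- (p + q))"] that(3)[of "nat (- p)" "nat (p + q)"]
        by auto
    qed
    then show ?thesis
    proof cases
      case 1
      then show ?thesis
        using euclid_count_add_left[of a b] b by (auto simp: linking_count_def nat_int_add mult_less_0_iff)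
    next
      case 2
      then have p: "p = - int (a + b)"
        using b by simp
      have "linking_count (p + q) q = - euclid_count a b"
        unfolding 2 linking_count_minus_left by (simp add: linking_count_def b mult_less_0_iff)
      moreover have "linking_count p q = - euclid_count (a + b) b"
        unfolding p linking_count_minus_left by (simp add: linking_count_def b mult_less_0_iff nat_int_add)
      ultimately show ?thesis
        using euclid_count_add_left[of a b] b by auto
    next
      case 3
      then have bac: "b = a + c"
        using b by simp
      have "linking_count (p + q) q = euclid_count c (c + a)"
        unfolding 3(2) unfolding b bac
        by (simp add: linking_count_def mult_less_0_iff nat_int_add add.commute)
      moreover have "linking_count p q = - euclid_count a (a + c)"
        unfolding \<open>p = - int a\<close> linking_count_minus_left
        using bac b by (simp add: linking_count_def mult_less_0_iff nat_int_add)
      ultimately show ?thesis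
        using bac b by (auto simp: euclid_count_add_right euclid_count_commute[of c a])
    qed
  qed
  show ?thesis
  proof (cases "q \<ge> 0")
    case False
    then show ?thesis
      using nonneg[of "- q" "- p"]
      by (simp add: linking_count_minus_left[of "p + q", simplified]
          linking_count_minus_left linking_count_minus_right)
  qed (rule nonneg)
qed

text \<open>A negative twist undoes a positive one, and negation is its own inverse.\<close>

lemma linking_count_horizontal:
  "linking_count (p + slope_int s * q) q =
     (if even q then - linking_count p q else linking_count p q + slope_int s)"
  using linking_count_add_left[of p q] linking_count_add_left[of "p - q" q] by (cases s) auto

lemma linking_count_vertical:
  "linking_count p (q + slope_int s * p) =
     (if even p then - linking_count p q else linking_count p q + slope_int s)"
  using linking_count_horizontal[of q s p] by (simp add: linking_count_commute)

text \<open>A reduced fraction determines $p$ and $q$ up to a common sign, which the count does not see.\<close>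

lemma linking_count_fraction:
  assumes "coprime p q" "q \<noteq> 0" "coprime p' q'" "Some (Fract p q) = fraction p' q'"
  shows "linking_count p q = linking_count p' q'"
proof -
  have q': "q' \<noteq> 0" and eq: "p * q' = p' * q"
    using assms by (auto simp: fraction_def eq_rat split: if_splits)
  have "\<bar>p\<bar> * \<bar>q'\<bar> = \<bar>p'\<bar> * \<bar>q\<bar>"
    using eq by (metis abs_mult)
  then have abs: "\<bar>p\<bar> = \<bar>p'\<bar>" "\<bar>q\<bar> = \<bar>q'\<bar>"
    using coprime_crossproduct_int[of p q p' q'] assms(1,3) by (auto simp: coprime_commute)
  then have "(p' = p \<and> q' = q) \<or> (p' = - p \<and> q' = - q)"
    using eq assms(2) by (auto simp: abs_eq_iff)
  then show ?thesis
    by (auto simp: linking_count_minus_left linking_count_minus_right)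
qed

section \<open>Crossings between the two strands of a tangle\<close>

text \<open>
  The two strands are recorded as a Boolean colour of the arcs, so that a crossing between
  different strands is one where the two diagonals have different colours.
\<close>

definition strand_colouring :: "tangle \<Rightarrow> (corner \<Rightarrow> corner) \<Rightarrow> (nat \<Rightarrow> bool) \<Rightarrow> bool" where
  "strand_colouring T m g \<longleftrightarrow>
     (\<forall>(a, b) \<in> tangle_step T. g a = g b) \<and>
     (\<forall>c c'. g (ends T c) = g (ends T c') \<longleftrightarrow> c' = c \<or> c' = m c)"

text \<open>
  The colours at NW and NE decide, since each diagonal of a crossing has a single colour. The
  sign of a crossing sees only the slope and the exits, so the closure may be used
  to compute it for any orientation of the tangle, even when the two strands do not close up
  to an oriented link.
\<close>

definition strand_linking :: "tangle \<Rightarrow> port set \<Rightarrow> (nat \<Rightarrow> bool) \<Rightarrow> rat" where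
  "strand_linking T D g =
     (\<Sum>i<length (crossings T).
        if g (arc_at (crossings T ! i) NW) \<noteq> g (arc_at (crossings T ! i) NE)
        then crossing_sign (numerator_closure T D) i else 0)"

lemma crossing_sign_numerator_closure:
  assumes "i < length (crossings T)"
  shows "crossing_sign (numerator_closure T D) i =
     (if \<exists>c. c \<notin> over_corners (over_slope (crossings T ! i)) \<and> Cr i c \<in> D \<and> Cr i (clockwise c) \<in> D
      then 1 else -1)"
  using assms by (simp add: crossing_sign_def numerator_closure_def)

lemma ex_corner: "(\<exists>c. P c) \<longleftrightarrow> P NW \<or> P NE \<or> P SW \<or> P SE"
  by (metis corner.exhaust)

lemma orientation_through_crossing:
  "orientation T D \<Longrightarrow> i < length (crossings T) \<Longrightarrow> Cr i c \<in> D \<longleftrightarrow> Cr i (opp c) \<notin> D"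
  unfolding orientation_def by blast

text \<open>
  An orientation of a twisted tangle restricts to the tangle before the twist: the ports
  \<open>Bd e\<close> and \<open>Bd f\<close> of the latter have become the glued corners \<open>u\<close> and \<open>v\<close>. Running straight
  through the new crossing shows that the directions at the two ends are exchanged.
\<close>

lemma orientation_before_attach:
  assumes uv: "u \<noteq> v" "v \<noteq> opp u" and ef: "e \<noteq> f"
    and D': "orientation (attach s u v e f x y T) D'"
  obtains D where "orientation T D" "\<And>c. Bd c \<in> D \<longleftrightarrow> Bd (swap e f c) \<in> D'"
    "\<And>i c. i < length (crossings T) \<Longrightarrow> Cr i c \<in> D \<longleftrightarrow> Cr i c \<in> D'"
    "Cr (length (crossings T)) u \<in> D' \<longleftrightarrow> Bd e \<in> D"
    "Cr (length (crossings T)) v \<in> D' \<longleftrightarrow> Bd f \<in> D"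
proof -
  define n where "n = length (crossings T)"
  let ?T = "attach s u v e f x y T"
  \<comment> \<open>\<open>\<psi>\<close> embeds the old ports into the new ones, keeping the arc at each port.\<close>
  define \<psi> where "\<psi> p = (if p = Bd e then Cr n u else if p = Bd f then Cr n v else p)" for p
  define D where "D = {p \<in> ports T. \<psi> p \<in> D'}"
  have len: "length (crossings ?T) = Suc n"
    by (simp add: attach_def n_def)
  have \<psi>: "\<psi> p \<in> ports ?T" "port_arc ?T (\<psi> p) = port_arc T p" if "p \<in> ports T" for p
    using that uv ef by (auto simp: \<psi>_def ports_def attach_def n_def nth_append split: if_splits)
  have inj: "p = p'" if "\<psi> p = \<psi> p'" "p \<in> ports T" "p' \<in> ports T" for p p'
    using that uv ef by (auto simp: \<psi>_def ports_def n_def split: if_splits)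
  have opp: "Cr i c \<in> D' \<longleftrightarrow> Cr i (opp c) \<notin> D'" if "i < Suc n" for i c
    by (rule orientation_through_crossing[OF D']) (use that len in simp)
  have glue: "p \<in> D' \<longleftrightarrow> p' \<notin> D'"
    if "p \<in> ports ?T" "p' \<in> ports ?T" "p \<noteq> p'" "port_arc ?T p = port_arc ?T p'" for p p'
    using D' that unfolding orientation_def by blast
  have old: "Cr i c \<in> D \<longleftrightarrow> Cr i c \<in> D'" if "i < n" for i c
    using that by (simp add: D_def \<psi>_def ports_def n_def)
  have "orientation T D"
    unfolding orientation_def
  proof (intro conjI allI impI ballI)
    show "D \<subseteq> ports T"
      by (auto simp: D_def)
    show "Cr i c \<in> D \<longleftrightarrow> Cr i (opp c) \<notin> D" if "i < length (crossings T)" for i c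
      using that opp[of i c] old by (simp add: n_def)
    show "p \<in> D \<longleftrightarrow> p' \<notin> D"
      if "p \<in> ports T" "p' \<in> ports T" "p \<noteq> p' \<and> port_arc T p = port_arc T p'" for p p'
      using glue[of "\<psi> p" "\<psi> p'"] \<psi> inj that unfolding D_def by auto
  qed
  moreover have u: "Cr n u \<in> D' \<longleftrightarrow> Bd e \<in> D" and v: "Cr n v \<in> D' \<longleftrightarrow> Bd f \<in> D"
    using ef by (auto simp: D_def \<psi>_def ports_def)
  moreover have "Bd c \<in> D \<longleftrightarrow> Bd (swap e f c) \<in> D'" for c
  proof -
    have "Cr n (opp u) \<in> ports ?T" "Cr n (opp v) \<in> ports ?T" "range Bd \<subseteq> ports ?T"
      by (auto simp: ports_def len)
    moreover have "opp u \<noteq> v" "opp v \<noteq> u"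
      using uv by auto
    then have "port_arc ?T (Cr n (opp u)) = port_arc ?T (Bd f)"
      "port_arc ?T (Cr n (opp v)) = port_arc ?T (Bd e)"
      using ef uv by (auto simp: attach_def n_def)
    ultimately have "Cr n (opp u) \<in> D' \<longleftrightarrow> Bd f \<notin> D'" "Cr n (opp v) \<in> D' \<longleftrightarrow> Bd e \<notin> D'"
      using glue by blast+
    then have "Bd e \<in> D \<longleftrightarrow> Bd f \<in> D'" "Bd f \<in> D \<longleftrightarrow> Bd e \<in> D'"
      using opp[of n u] opp[of n v] u v by auto
    then show ?thesis
      by (auto simp: swap_def D_def \<psi>_def ports_def)
  qed
  ultimately show thesis
    using that old unfolding n_def by blast
qed

text \<open>Since the new crossing exchanges the two ends, the pairing of the ends is conjugated by \<open>swap\<close>.\<close>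

lemma colouring_before_attach:
  assumes uv: "u \<noteq> v" "v \<noteq> opp u" and ef: "e \<noteq> f"
    and g: "strand_colouring (attach s u v e f x y T) (swap e f \<circ> m \<circ> swap e f) g"
  shows "strand_colouring T m g"
proof -
  let ?T = "attach s u v e f x y T"
  note step = attach_step[OF uv, of s e f x y T]
  have sw: "swap e f (swap e f c) = c" for c
    by (auto simp: swap_def)
  have const: "g a = g b" if "(a, b) \<in> tangle_step ?T" for a b
    using g that unfolding strand_colouring_def by blast
  have sep: "g (ends ?T c) = g (ends ?T c') \<longleftrightarrow> c' = c \<or> c' = swap e f (m (swap e f c))" for c c'
    using g unfolding strand_colouring_def comp_apply by blast
  have ends: "g (ends T c) = g (ends ?T (swap e f c))" for c
    using const[of "ends T e" y] const[of "ends T f" x] ef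
    by (auto simp: step attach_ends swap_def)
  have "g (ends T c) = g (ends T c') \<longleftrightarrow> c' = c \<or> c' = m c" for c c'
    unfolding ends sep sw by (metis sw)
  then show ?thesis
    using const unfolding strand_colouring_def step by blast
qed

lemma strand_linking_attach:
  assumes "\<And>i c. i < length (crossings T) \<Longrightarrow> Cr i c \<in> D \<longleftrightarrow> Cr i c \<in> D'"
  shows "strand_linking (attach s u v e f x y T) D' g =
    strand_linking T D g +
    (let a = arc_at (last (crossings (attach s u v e f x y T)))
     in if g (a NW) \<noteq> g (a NE)
        then crossing_sign (numerator_closure (attach s u v e f x y T) D') (length (crossings T))
        else 0)"
proof -
  let ?T = "attach s u v e f x y T"
  have "crossing_sign (numerator_closure ?T D') i = crossing_sign (numerator_closure T D) i"
    if "i < length (crossings T)" for i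
  proof -
    have "crossings ?T ! i = crossings T ! i" "i < length (crossings ?T)"
      using that by (simp_all add: attach_def nth_append)
    then show ?thesis
      using that assms by (simp add: crossing_sign_numerator_closure)
  qed
  moreover have "crossings ?T ! i = crossings T ! i" if "i < length (crossings T)" for i
    using that by (simp add: attach_def nth_append)
  moreover have "length (crossings ?T) = Suc (length (crossings T))"
    "crossings ?T ! length (crossings T) = last (crossings ?T)"
    by (simp_all add: attach_def)
  ultimately show ?thesis
    by (simp add: strand_linking_def Let_def cong: if_cong)
qed

text \<open>
  The invariant of the induction. It speaks of both relative orientations of the strands, the factor
  comparing the given one with the conventional one, because a twist of a strand with itself
  exchanges the two.
\<close>

definition counted_by :: "tangle \<Rightarrow> int \<Rightarrow> int \<Rightarrow> bool" where
  "counted_by T p q \<longleftrightarrow>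
     (\<forall>D g. orientation T D \<and> (\<forall>c. Bd c \<in> D \<longleftrightarrow> Bd (mate p q c) \<notin> D) \<and>
        strand_colouring T (mate p q) g \<longrightarrow>
        strand_linking T D g =
          (if Bd SW \<in> D \<longleftrightarrow> Bd (if even p then NE else SE) \<in> D then 1 else -1) *
          of_int (linking_count p q))"

text \<open>What both kinds of twists have in common: the invariant before the twist, on the restricted data.\<close>

lemma counted_by_before_attach:
  assumes uv: "u \<noteq> v" "v \<noteq> opp u" and ef: "e \<noteq> f"
    and m: "swap e f \<circ> mate p q \<circ> swap e f = mate p' q'"
    and T: "counted_by T p q"
    and D': "orientation (attach s u v e f x y T) D'" "\<forall>c. Bd c \<in> D' \<longleftrightarrow> Bd (mate p' q' c) \<notin> D'"
    and g: "strand_colouring (attach s u v e f x y T) (mate p' q') g"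
  obtains D where "orientation T D" "\<And>c. Bd c \<in> D \<longleftrightarrow> Bd (swap e f c) \<in> D'"
    "\<And>i c. i < length (crossings T) \<Longrightarrow> Cr i c \<in> D \<longleftrightarrow> Cr i c \<in> D'"
    "Cr (length (crossings T)) u \<in> D' \<longleftrightarrow> Bd e \<in> D"
    "Cr (length (crossings T)) v \<in> D' \<longleftrightarrow> Bd f \<in> D"
    "\<And>c. Bd c \<in> D \<longleftrightarrow> Bd (mate p q c) \<notin> D"
    "strand_colouring T (mate p q) g"
    "strand_linking T D g =
          (if Bd SW \<in> D \<longleftrightarrow> Bd (if even p then NE else SE) \<in> D then 1 else -1) *
          of_int (linking_count p q)"
proof -
  obtain D where D: "orientation T D" "\<And>c. Bd c \<in> D \<longleftrightarrow> Bd (swap e f c) \<in> D'"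
    "\<And>i c. i < length (crossings T) \<Longrightarrow> Cr i c \<in> D \<longleftrightarrow> Cr i c \<in> D'"
    "Cr (length (crossings T)) u \<in> D' \<longleftrightarrow> Bd e \<in> D"
    "Cr (length (crossings T)) v \<in> D' \<longleftrightarrow> Bd f \<in> D"
    using orientation_before_attach[OF uv ef D'(1)] by blast
  have sw: "swap e f (swap e f c) = c" for c
    by (auto simp: swap_def)
  have m': "mate p' q' (swap e f c) = swap e f (mate p q c)" for c
    using fun_cong[OF m, of "swap e f c"] by (simp add: sw)
  have alt: "Bd c \<in> D \<longleftrightarrow> Bd (mate p q c) \<notin> D" for c
    using D'(2)[rule_format, of "swap e f c"] by (simp add: D(2) m')
  have col: "strand_colouring T (mate p q) g"
    using colouring_before_attach[OF uv ef] g m by metis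
  show thesis
    using that[OF D alt col] T alt col D(1) unfolding counted_by_def by blast
qed

text \<open>
  Two strands that both enter or both leave the tangle at the twisted ends NE and SE pass the new
  crossing in parallel and horizontally, which makes $[+1]$ a negative crossing; otherwise they are
  antiparallel and it is positive. In the conventional orientation the latter happens whenever
  the two strands are different.
\<close>

lemma counted_by_horizontal:
  assumes pq: "coprime p q" and T: "counted_by T p q"
  shows "counted_by (horizontal_twist s x y T) (p + slope_int s * q) q"
  unfolding counted_by_def horizontal_attach
proof (intro allI impI, elim conjE)
  fix D' g
  let ?T = "attach s NW SW NE SE x y T"
  let ?n = "length (crossings T)"
  assume D': "orientation ?T D'"
    "\<forall>c. Bd c \<in> D' \<longleftrightarrow> Bd (mate (p + slope_int s * q) q c) \<notin> D'"
    and g: "strand_colouring ?T (mate (p + slope_int s * q) q) g"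
  have corners: "NW \<noteq> SW" "SW \<noteq> opp NW" "NE \<noteq> SE"
    by simp_all
  obtain D where "orientation T D" and D: "\<And>c. Bd c \<in> D \<longleftrightarrow> Bd (swap NE SE c) \<in> D'"
      "\<And>i c. i < ?n \<Longrightarrow> Cr i c \<in> D \<longleftrightarrow> Cr i c \<in> D'"
      "Cr ?n NW \<in> D' \<longleftrightarrow> Bd NE \<in> D" "Cr ?n SW \<in> D' \<longleftrightarrow> Bd SE \<in> D"
    and alt: "\<And>c. Bd c \<in> D \<longleftrightarrow> Bd (mate p q c) \<notin> D"
    and col: "strand_colouring T (mate p q) g"
    and IH: "strand_linking T D g =
          (if Bd SW \<in> D \<longleftrightarrow> Bd (if even p then NE else SE) \<in> D then 1 else -1) *
          of_int (linking_count p q)"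
    by (rule counted_by_before_attach[OF corners mate_horizontal[OF pq] T D' g])
      (rule that, assumption+)
  have ends: "Bd SW \<in> D' \<longleftrightarrow> Bd SW \<in> D" "Bd NE \<in> D' \<longleftrightarrow> Bd SE \<in> D" "Bd SE \<in> D' \<longleftrightarrow> Bd NE \<in> D"
    by (simp_all add: D(1) swap_def)
  have opp: "Cr ?n c \<in> D' \<longleftrightarrow> Cr ?n (opp c) \<notin> D'" for c
    by (rule orientation_through_crossing[OF D'(1)]) (simp add: attach_def)
  have exits: "Cr ?n SE \<in> D' \<longleftrightarrow> Bd NE \<notin> D" "Cr ?n NE \<in> D' \<longleftrightarrow> Bd SE \<notin> D"
    using opp[of SE] opp[of NE] D(3,4) by simp_all
  have new: "arc_at (last (crossings ?T)) NW = ends T NE" "arc_at (last (crossings ?T)) NE = x"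
    by (simp_all add: attach_def)
  have sign: "crossing_sign (numerator_closure ?T D') ?n =
      of_int (slope_int s) * (if Bd NE \<in> D \<longleftrightarrow> Bd SE \<in> D then -1 else 1)"
    by (cases s) (auto simp: crossing_sign_numerator_closure ex_corner attach_def D(3,4) exits)
  have const: "g a = g b" if "(a, b) \<in> tangle_step ?T" for a b
    using g that unfolding strand_colouring_def by blast
  have "g (ends T SE) = g x"
    using const[of "ends T SE" x] by (simp add: attach_step)
  moreover have "g (ends T NE) = g (ends T SE) \<longleftrightarrow> SE = NE \<or> SE = mate p q NE"
    using col unfolding strand_colouring_def by blast
  then have "g (ends T NE) = g (ends T SE) \<longleftrightarrow> even q"
    using pq by (auto simp: mate_def)
  ultimately have sum: "strand_linking ?T D' g = strand_linking T D g +
     (if even q then 0 else of_int (slope_int s) * (if Bd NE \<in> D \<longleftrightarrow> Bd SE \<in> D then -1 else 1))"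
    using new by (auto simp: strand_linking_attach[OF D(2)] sign Let_def)
  have "\<not> (even p \<and> even q)"
    using pq by auto
  then consider "even q" "odd p" | "even p" "odd q" | "odd p" "odd q"
    by blast
  then show "strand_linking ?T D' g =
      (if Bd SW \<in> D' \<longleftrightarrow> Bd (if even (p + slope_int s * q) then NE else SE) \<in> D' then 1 else -1) *
       of_int (linking_count (p + slope_int s * q) q)"
  proof cases
    case 1
    then have "Bd NE \<in> D \<longleftrightarrow> Bd SE \<notin> D"
      using alt[of NE] by (simp add: mate_def)
    with 1 show ?thesis
      unfolding sum IH linking_count_horizontal by (simp add: ends)
  next
    case 2
    then have "odd (p + slope_int s * q)" "Bd SE \<in> D \<longleftrightarrow> Bd SW \<notin> D"
      using alt[of SE] by (cases s; simp add: mate_def)+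
    with 2 show ?thesis
      unfolding sum IH linking_count_horizontal by (auto simp: ends algebra_simps)
  next
    case 3
    then have "even (p + slope_int s * q)" "Bd NE \<in> D \<longleftrightarrow> Bd SW \<notin> D"
      using alt[of NE] by (cases s; simp add: mate_def)+
    with 3 show ?thesis
      unfolding sum IH linking_count_horizontal by (auto simp: ends algebra_simps)
  qed
qed

text \<open>
  For vertical twists the rule is opposite: parallel strands passing the crossing vertically make
  $[+1]$ a positive crossing, and in the conventional orientation both strands enter at SW and
  SE whenever these ends belong to different strands.
\<close>

lemma counted_by_vertical:
  assumes pq: "coprime p q" and T: "counted_by T p q"
  shows "counted_by (vertical_twist s x y T) p (q + slope_int s * p)"
  unfolding counted_by_def vertical_attach
proof (intro allI impI, elim conjE)
  fix D' g
  let ?T = "attach s NW NE SW SE x y T"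
  let ?n = "length (crossings T)"
  assume D': "orientation ?T D'"
    "\<forall>c. Bd c \<in> D' \<longleftrightarrow> Bd (mate p (q + slope_int s * p) c) \<notin> D'"
    and g: "strand_colouring ?T (mate p (q + slope_int s * p)) g"
  have corners: "NW \<noteq> NE" "NE \<noteq> opp NW" "SW \<noteq> SE"
    by simp_all
  obtain D where "orientation T D" and D: "\<And>c. Bd c \<in> D \<longleftrightarrow> Bd (swap SW SE c) \<in> D'"
      "\<And>i c. i < ?n \<Longrightarrow> Cr i c \<in> D \<longleftrightarrow> Cr i c \<in> D'"
      "Cr ?n NW \<in> D' \<longleftrightarrow> Bd SW \<in> D" "Cr ?n NE \<in> D' \<longleftrightarrow> Bd SE \<in> D"
    and alt: "\<And>c. Bd c \<in> D \<longleftrightarrow> Bd (mate p q c) \<notin> D"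
    and col: "strand_colouring T (mate p q) g"
    and IH: "strand_linking T D g =
          (if Bd SW \<in> D \<longleftrightarrow> Bd (if even p then NE else SE) \<in> D then 1 else -1) *
          of_int (linking_count p q)"
    by (rule counted_by_before_attach[OF corners mate_vertical[OF pq] T D' g])
      (rule that, assumption+)
  have ends: "Bd NE \<in> D' \<longleftrightarrow> Bd NE \<in> D" "Bd SW \<in> D' \<longleftrightarrow> Bd SE \<in> D" "Bd SE \<in> D' \<longleftrightarrow> Bd SW \<in> D"
    by (simp_all add: D(1) swap_def)
  have opp: "Cr ?n c \<in> D' \<longleftrightarrow> Cr ?n (opp c) \<notin> D'" for c
    by (rule orientation_through_crossing[OF D'(1)]) (simp add: attach_def)
  have exits: "Cr ?n SE \<in> D' \<longleftrightarrow> Bd SW \<notin> D" "Cr ?n SW \<in> D' \<longleftrightarrow> Bd SE \<notin> D"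
    using opp[of SE] opp[of SW] D(3,4) by simp_all
  have new: "arc_at (last (crossings ?T)) NW = ends T SW" "arc_at (last (crossings ?T)) NE = ends T SE"
    by (simp_all add: attach_def)
  have sign: "crossing_sign (numerator_closure ?T D') ?n =
      of_int (slope_int s) * (if Bd SW \<in> D \<longleftrightarrow> Bd SE \<in> D then 1 else -1)"
    by (cases s) (auto simp: crossing_sign_numerator_closure ex_corner attach_def D(3,4) exits)
  have "g (ends T SW) = g (ends T SE) \<longleftrightarrow> SE = SW \<or> SE = mate p q SW"
    using col unfolding strand_colouring_def by blast
  then have "g (ends T SW) = g (ends T SE) \<longleftrightarrow> even p"
    by (auto simp: mate_def)
  then have sum: "strand_linking ?T D' g = strand_linking T D g +
     (if even p then 0 else of_int (slope_int s) * (if Bd SW \<in> D \<longleftrightarrow> Bd SE \<in> D then 1 else -1))"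
    using new by (auto simp: strand_linking_attach[OF D(2)] sign Let_def)
  show "strand_linking ?T D' g =
      (if Bd SW \<in> D' \<longleftrightarrow> Bd (if even p then NE else SE) \<in> D' then 1 else -1) *
       of_int (linking_count p (q + slope_int s * p))"
  proof (cases "even p")
    case True
    then have "Bd SW \<in> D \<longleftrightarrow> Bd SE \<notin> D"
      using alt[of SW] by (simp add: mate_def)
    with True show ?thesis
      unfolding sum IH linking_count_vertical by (simp add: ends)
  next
    case False
    then show ?thesis
      unfolding sum IH linking_count_vertical by (auto simp: ends algebra_simps)
  qed
qed

lemma rational_tangle_counted_by:
  "rational_tangle T F \<Longrightarrow>
     \<exists>p q. coprime p q \<and> F = fraction p q \<and> connects T (mate p q) \<and> counted_by T p q"
proof (induction rule: rational_tangle.induct)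
  case (trivial x y)
  have "strand_linking (trivial_tangle x y) D g = 0" for D g
    by (simp add: strand_linking_def trivial_tangle_def)
  moreover have "linking_count 0 1 = 0"
    by (simp add: linking_count_def)
  ultimately have "counted_by (trivial_tangle x y) 0 1"
    by (simp only: counted_by_def of_int_0 mult_zero_right simp_thms)
  then show ?case
    using trivial_connects[OF trivial]
    by (intro exI[of _ 0] exI[of _ 1]) (auto simp: fraction_def Zero_rat_def)
next
  case (horizontal T F x y s)
  then obtain p q where pq: "coprime p q" "F = fraction p q" "connects T (mate p q)" "counted_by T p q"
    by blast
  have "connects (horizontal_twist s x y T) (swap NE SE \<circ> mate p q \<circ> swap NE SE)"
    unfolding horizontal_attach by (rule attach_connects) (use horizontal pq in auto)
  then show ?case
    using pq ext_add_frac coprime_add_slope mate_horizontal counted_by_horizontal by metis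
next
  case (vertical T F x y s)
  then obtain p q where pq: "coprime p q" "F = fraction p q" "connects T (mate p q)" "counted_by T p q"
    by blast
  have "connects (vertical_twist s x y T) (swap SW SE \<circ> mate p q \<circ> swap SW SE)"
    unfolding vertical_attach by (rule attach_connects) (use vertical pq in auto)
  moreover have "coprime p (q + slope_int s * p)" "coprime (q + slope_int s * p) p"
    using coprime_add_slope[of q p s] pq(1) by (simp_all add: ac_simps)
  ultimately show ?case
    using pq ext_add_frac ext_inverse_frac mate_vertical coprime_commute counted_by_vertical by metis
qed

section \<open>The linking number of a rational link\<close>

text \<open>
  For even $p$ the closure joins ends of equal colour, so the colouring descends to the link. It is
  constant on components and takes different values at NW and SW, so its two colours are
  exactly the two components.
\<close>

lemma linking_number_numerator_closure:
  assumes g: "strand_colouring T (mate p q) g" and p: "even p"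
    and comps: "components (numerator_closure T D) = {A, B}" "A \<noteq> B"
  shows "linking_number (numerator_closure T D) A B = strand_linking T D g / 2"
proof -
  let ?L = "numerator_closure T D"
  let ?R = "(strand_step ?L)\<^sup>*"
  define \<rho> where "\<rho> = closure_arc T"
  have gT: "g a = g b" if "(a, b) \<in> tangle_step T" for a b
    using g that unfolding strand_colouring_def by blast
  have gE: "g (ends T c) = g (ends T c') \<longleftrightarrow> c' = c \<or> c' = mate p q c" for c c'
    using g unfolding strand_colouring_def by blast
  have ends: "g (ends T NE) = g (ends T NW)" "g (ends T SE) = g (ends T SW)"
      "g (ends T NW) \<noteq> g (ends T SW)"
    using p by (auto simp: gE mate_def)
  have g_merge: "g (merge x y a) = g a" if "g x = g y" for x y a
    using that by (simp add: merge_def)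
  have g\<rho>: "g (\<rho> a) = g a" for a
    using ends(1,2) by (simp only: \<rho>_def closure_arc_def Let_def comp_apply g_merge)
  have stepL: "strand_step ?L = (\<lambda>(a, b). (\<rho> a, \<rho> b)) ` tangle_step T"
    by (simp add: strand_step_Union tangle_step_Union numerator_closure_def \<rho>_def
        image_UN image_image)
  have gR: "g a = g b" if "(a, b) \<in> ?R" for a b
    using that
  proof (induction rule: rtrancl_induct)
    case (step b c)
    then obtain b' c' where "(b', c') \<in> tangle_step T" "b = \<rho> b'" "c = \<rho> c'"
      unfolding stepL by auto
    then have "g b = g c"
      using gT by (simp add: g\<rho>)
    then show ?case
      using step.IH by simp
  qed simp
  have cls: "?R `` {a} \<in> {A, B}" if "a \<in> link_arcs ?L" for a
    using quotientI[OF that, of ?R] comps(1) unfolding components_def by simp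
  have const: "g a = g b" if "a \<in> K" "b \<in> K" "K \<in> {A, B}" for a b K
  proof -
    have "K \<in> link_arcs ?L // ?R"
      using that(3) comps(1) unfolding components_def by blast
    then obtain z where "K = ?R `` {z}"
      by (rule quotientE)
    then have "g z = g a" "g z = g b"
      using that(1,2) gR by blast+
    then show ?thesis
      by simp
  qed
  have NS: "\<rho> (ends T NW) \<in> link_arcs ?L" "\<rho> (ends T SW) \<in> link_arcs ?L"
    by (auto simp: numerator_closure_def \<rho>_def arcs_def)
  have in_cls: "a \<in> A \<or> a \<in> B" if "a \<in> link_arcs ?L" for a
    using cls[OF that] by blast
  obtain K K' where K: "{K, K'} = {A, B}" "\<rho> (ends T NW) \<in> K" "\<rho> (ends T SW) \<in> K'"
  proof -
    have "\<rho> (ends T SW) \<notin> J" if "\<rho> (ends T NW) \<in> J" "J \<in> {A, B}" for J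
      using const[OF that(1) _ that(2)] ends(3) g\<rho> by blast
    then show thesis
      using that[of A B] that[of B A] in_cls[OF NS(1)] in_cls[OF NS(2)] by (auto simp: insert_commute)
  qed
  have colour: "(a \<in> K \<longleftrightarrow> g a = g (ends T NW)) \<and> (a \<in> K' \<longleftrightarrow> g a \<noteq> g (ends T NW))" if "a \<in> link_arcs ?L" for a
  proof -
    have "a \<in> K \<or> a \<in> K'"
      using in_cls[OF that] K(1) by (auto simp: doubleton_eq_iff)
    moreover have "g a = g (ends T NW)" if "a \<in> K"
      using const[OF that K(2)] K(1) by (auto simp: g\<rho>)
    moreover have "g a = g (ends T SW)" if "a \<in> K'"
      using const[OF that K(3)] K(1) by (auto simp: g\<rho>)
    ultimately show ?thesis
      using ends(3) by auto
  qed
  obtain t where t: "\<And>a. a \<in> link_arcs ?L \<Longrightarrow> (a \<in> A \<longleftrightarrow> g a = t) \<and> (a \<in> B \<longleftrightarrow> g a \<noteq> t)"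
  proof -
    consider "A = K" "B = K'" | "A = K'" "B = K"
      using K(1) by (auto simp: doubleton_eq_iff)
    then show thesis
    proof cases
      case 1
      show thesis
        by (rule that[of "g (ends T NW)"]) (use colour 1 in blast)
    next
      case 2
      show thesis
        by (rule that[of "\<not> g (ends T NW)"]) (use colour 2 in blast)
    qed
  qed
  have crosses: "crosses_over (link_crossings ?L ! i) A B \<or> crosses_over (link_crossings ?L ! i) B A \<longleftrightarrow>
      g (arc_at (crossings T ! i) NW) \<noteq> g (arc_at (crossings T ! i) NE)"
    if i: "i < length (crossings T)" for i
  proof -
    let ?k = "crossings T ! i"
    have k: "arc_at (link_crossings ?L ! i) = \<rho> \<circ> arc_at ?k"
      "over_slope (link_crossings ?L ! i) = over_slope ?k"
      using i by (simp_all add: numerator_closure_def \<rho>_def)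
    have "\<rho> (arc_at ?k c) \<in> link_arcs ?L" for c
      using i nth_mem by (fastforce simp: numerator_closure_def \<rho>_def arcs_def)
    then have AB: "\<rho> (arc_at ?k c) \<in> A \<longleftrightarrow> g (arc_at ?k c) = t"
      "\<rho> (arc_at ?k c) \<in> B \<longleftrightarrow> g (arc_at ?k c) \<noteq> t" for c
      using t g\<rho> by simp_all
    have "(arc_at ?k c, arc_at ?k (opp c)) \<in> tangle_step T" for c
      using i nth_mem unfolding tangle_step_def by blast
    then have "g (arc_at ?k c) = g (arc_at ?k (opp c))" for c
      using gT by blast
    from this[of NW] this[of NE]
    have "g (arc_at ?k NW) = g (arc_at ?k SE)" "g (arc_at ?k NE) = g (arc_at ?k SW)"
      by simp_all
    moreover have all: "(\<forall>c. P c) \<longleftrightarrow> P NW \<and> P NE \<and> P SW \<and> P SE" for P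
      by (metis corner.exhaust)
    ultimately show ?thesis
      by (cases "over_slope ?k") (auto simp: crosses_over_def k all AB)
  qed
  have len: "length (link_crossings ?L) = length (crossings T)"
    by (simp add: numerator_closure_def)
  have "{i. i < length (link_crossings ?L) \<and>
      (crosses_over (link_crossings ?L ! i) A B \<or> crosses_over (link_crossings ?L ! i) B A)} =
    {i \<in> {..<length (crossings T)}.
      g (arc_at (crossings T ! i) NW) \<noteq> g (arc_at (crossings T ! i) NE)}"
    unfolding len using crosses by blast
  then show ?thesis
    unfolding linking_number_def strand_linking_def by (simp only: sum.inter_filter finite_lessThan)
qed

text \<open>The orientation of $R_{p/q}$ is the conventional one, so the factor in \<open>counted_by\<close> is $1$.\<close>

lemma lk_rational_link:
  assumes pq: "coprime p q" "even p" and L: "L \<in> rational_link p q"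
  shows "lk L = of_int (linking_count p q) / 2"
proof -
  obtain T D where T: "L = numerator_closure T D" "rational_tangle T (Some (Fract p q))"
    and D: "orientation T D" "Bd NE \<in> D" "Bd NW \<notin> D" "Bd SW \<in> D" "Bd SE \<notin> D"
    using L by (auto simp: rational_link_def)
  obtain p' q' where p': "coprime p' q'" "Some (Fract p q) = fraction p' q'"
      "connects T (mate p' q')" "counted_by T p' q'"
    using rational_tangle_counted_by[OF T(2)] by blast
  have ev: "even p'"
    using even_numerator[OF pq p'(1,2)] .
  have "q \<noteq> 0"
    using pq by (metis coprime_common_divisor dvd_0_right odd_one)
  then have count: "linking_count p q = linking_count p' q'"
    using linking_count_fraction pq(1) p'(1,2) by blast
  obtain g where g: "strand_colouring T (mate p' q') g"
    using p'(3) unfolding connects_def strand_colouring_def by blast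
  obtain A B where AB: "components L = {A, B}" "A \<noteq> B"
    using rational_link_components[OF pq L] by blast
  have "Bd c \<in> D \<longleftrightarrow> Bd (mate p' q' c) \<notin> D" for c
    using ev D by (cases c) (auto simp: mate_def)
  then have "strand_linking T D g =
      (if Bd SW \<in> D \<longleftrightarrow> Bd (if even p' then NE else SE) \<in> D then 1 else -1) *
      of_int (linking_count p' q')"
    using p'(4) D(1) g unfolding counted_by_def by blast
  then have "strand_linking T D g = of_int (linking_count p' q')"
    by (simp add: D ev)
  then show ?thesis
    using lk_eq[OF AB] linking_number_numerator_closure[OF g ev AB[unfolded T(1)]]
    by (simp add: T(1) count)
qed

theorem proposition2:
  shows "(\<forall>L \<in> rational_link 0 1. lk L = 0) \<and>
    (\<forall>p q. coprime p q \<and> even p \<longrightarrow>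
       (\<forall>L \<in> rational_link p q. \<forall>L' \<in> rational_link (- p) q. lk L = - lk L')) \<and>
    (\<forall>p q. coprime p q \<and> even p \<longrightarrow>
       (\<forall>L \<in> rational_link p q. \<forall>L' \<in> rational_link (p + 2 * q) q. lk L = lk L' - 1)) \<and>
    (\<forall>p q. coprime p q \<and> even p \<longrightarrow>
       (\<forall>L \<in> rational_link p q. \<forall>L' \<in> rational_link p (p + q). lk L = - lk L'))"
proof (intro conjI ballI allI impI; (elim conjE)?)
  fix L
  assume "L \<in> rational_link 0 1"
  then show "lk L = 0"
    using lk_rational_link[of 0 1 L] by (simp add: linking_count_def)
next
  fix p q L L'
  assume "coprime p q" "even p" "L \<in> rational_link p q" "L' \<in> rational_link (- p) q"
  then show "lk L = - lk L'"
    using lk_rational_link[of p q L] lk_rational_link[of "- p" q L']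
    by (simp add: linking_count_minus_left)
next
  fix p q L L'
  assume *: "coprime p q" "even p" "L \<in> rational_link p q" "L' \<in> rational_link (p + 2 * q) q"
  have "odd q"
    using *(1,2) by auto
  then have "linking_count (p + 2 * q) q = linking_count p q + 2"
    using linking_count_add_left[of p q] linking_count_add_left[of "p + q" q] by (simp add: algebra_simps)
  moreover have "coprime (p + 2 * q) q"
    using *(1) coprime_add_slope[of p q Pos] coprime_add_slope[of "p + q" q Pos]
    by (simp add: algebra_simps)
  ultimately show "lk L = lk L' - 1"
    using * lk_rational_link[of p q L] lk_rational_link[of "p + 2 * q" q L']
    by simp
next
  fix p q L L'
  assume *: "coprime p q" "even p" "L \<in> rational_link p q" "L' \<in> rational_link p (p + q)"
  have "coprime p (p + q)"
    using *(1) coprime_add_slope[of q p Pos] by (simp add: ac_simps)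
  then show "lk L = - lk L'"
    using * lk_rational_link[of p q L] lk_rational_link[of p "p + q" L'] linking_count_vertical[of p q Pos]
    by (simp add: add.commute)
qed

end
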